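(* Assume that the Markov chains $\{\tilde{\boldsymbol Y}_n\}$, $\{\tilde{\boldsymbol Y}^{(1)}_n\}$ and $\{\tilde{\boldsymbol Y}^{(2)}_n\}$ are irreducible and aperiodic. Then the set $\bar\Gamma=\{(s_1,s_2)\in\mathbb{R}^2:\chi(e^{s_1},e^{s_2})\le 1\}$ is bounded.
   Context: Let $\mathbb{H}=\{-1,0,1\}$, $\mathbb{H}_+=\{0,1\}$, and let $S_0=\{1,\dots,s_0\}$ be a finite set. Let $A_{i,j}$ ($i,j\in\mathbb{H}$), $A^{(1)}_{i,j}$ ($i\in\mathbb{H},j\in\mathbb{H}_+$), $A^{(2)}_{i,j}$ ($i\in\mathbb{H}_+,j\in\mathbb{H}$) be nonnegative $s_0\times s_0$ matrices such that $\sum_{i,j}A_{i,j}$, $\sum_{i,j}A^{(1)}_{i,j}$, $\sum_{i,j}A^{(2)}_{i,j}$ are stochastic. Three Markov chains are defined by their block transition matrices (blocks indexed by the positions, entries of blocks by phases in $S_0$): - $\{\tilde{\boldsymbol Y}_n\}$ on $\mathbb{Z}^2\times S_0$: the block from $(x_1,x_2)$ to $(x_1+i,x_2+j)$ is $A_{i,j}$ for $i,j\in\mathbb{H}$, and all other blocks are zero. - $\{\tilde{\boldsymbol Y}^{(1)}_n\}$ on $\mathbb{Z}\times\mathbb{Z}_+\times S_0$: the block from $(x_1,x_2)$ to $(x_1+i,x_2+j)$ is $A_{i,j}$ if $x_2\neq0$ ($i,j\in\mathbb{H}$), and $A^{(1)}_{i,j}$ if $x_2=0$ ($i\in\mathbb{H},j\in\mathbb{H}_+$);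 all other blocks are zero. - $\{\tilde{\boldsymbol Y}^{(2)}_n\}$ on $\mathbb{Z}_+\times\mathbb{Z}\times S_0$: the block from $(x_1,x_2)$ to $(x_1+i,x_2+j)$ is $A_{i,j}$ if $x_1\neq0$ ($i,j\in\mathbb{H}$), and $A^{(2)}_{i,j}$ if $x_1=0$ ($i\in\mathbb{H}_+,j\in\mathbb{H}$); all other blocks are zero. For positive reals $z_1,z_2$, $C(z_1,z_2)=\sum_{i,j\in\mathbb{H}}A_{i,j}z_1^iz_2^j$ and $\chi(z_1,z_2)=\mathrm{spr}(C(z_1,z_2))$, where $\mathrm{spr}$ denotes spectral radius. *)

theory Defs
  imports
    "HOL-Analysis.Elementary_Normed_Spaces"
    "HOL-Analysis.Infinite_Sum"
    "Jordan_Normal_Form.Spectral_Radius"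
begin

section \<open>Markov chains on countable state spaces\<close>

text \<open>
  A chain is given by its state space \<open>S\<close> and its one-step transition matrix
  \<open>P :: 'a \<Rightarrow> 'a \<Rightarrow> real\<close>, used only on \<open>S\<close>. The matrices considered below have finitely many
  nonzero entries in each row, so the infinite sum has finitely many nonzero terms
  and the default value of \<open>infsum\<close> for divergent sums plays no role.
\<close>

fun n_step :: "'a set \<Rightarrow> ('a \<Rightarrow> 'a \<Rightarrow> real) \<Rightarrow> nat \<Rightarrow> 'a \<Rightarrow> 'a \<Rightarrow> real" where
  "n_step S P 0 x y = (if x = y then 1 else 0)"
| "n_step S P (Suc n) x y = (\<Sum>\<^sub>\<infinity>z\<in>S. P x z * n_step S P n z y)"

definition irreducible_chain :: "'a set \<Rightarrow> ('a \<Rightarrow> 'a \<Rightarrow> real) \<Rightarrow> bool" where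
  "irreducible_chain S P \<longleftrightarrow> (\<forall>x\<in>S. \<forall>y\<in>S. \<exists>n. n_step S P n x y > 0)"

definition period :: "'a set \<Rightarrow> ('a \<Rightarrow> 'a \<Rightarrow> real) \<Rightarrow> 'a \<Rightarrow> nat" where
  "period S P x = Gcd {n. n \<ge> 1 \<and> n_step S P n x x > 0}"

definition aperiodic_chain :: "'a set \<Rightarrow> ('a \<Rightarrow> 'a \<Rightarrow> real) \<Rightarrow> bool" where
  "aperiodic_chain S P \<longleftrightarrow> (\<forall>x\<in>S. period S P x = 1)"


section \<open>The block matrices\<close>

definition HH :: "int set" where "HH = {-1, 0, 1}"

definition HHp :: "int set" where "HHp = {0, 1}"

definition nonneg_mat :: "nat \<Rightarrow> real mat \<Rightarrow> bool" where
  "nonneg_mat n M \<longleftrightarrow> M \<in> carrier_mat n n \<and> (\<forall>k<n. \<forall>l<n. M $$ (k, l) \<ge> 0)"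

definition stochastic_mat :: "nat \<Rightarrow> real mat \<Rightarrow> bool" where
  "stochastic_mat n M \<longleftrightarrow> nonneg_mat n M \<and> (\<forall>k<n. (\<Sum>l<n. M $$ (k, l)) = 1)"

text \<open>The type of matrices has no zero element of unspecified dimension, so \<open>sum\<close> is not
  available on it; sums of matrices are written entrywise.\<close>

definition block_sum :: "nat \<Rightarrow> int set \<Rightarrow> int set \<Rightarrow> (int \<Rightarrow> int \<Rightarrow> real mat) \<Rightarrow> real mat" where
  "block_sum n I J B = mat n n (\<lambda>(k, l). \<Sum>i\<in>I. \<Sum>j\<in>J. B i j $$ (k, l))"

text \<open>A family \<open>B i j\<close> is constrained and used only for \<open>i \<in> I\<close> and \<open>j \<in> J\<close>.\<close>

definition stochastic_blocks ::
  "nat \<Rightarrow> int set \<Rightarrow> int set \<Rightarrow> (int \<Rightarrow> int \<Rightarrow> real mat) \<Rightarrow> bool" where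
  "stochastic_blocks n I J B \<longleftrightarrow>
     (\<forall>i\<in>I. \<forall>j\<in>J. nonneg_mat n (B i j)) \<and> stochastic_mat n (block_sum n I J B)"


section \<open>The three chains\<close>

text \<open>A state is \<open>(x1, x2, k)\<close> with position \<open>(x1, x2)\<close> and phase \<open>k\<close>. The phases
  \<open>1, \<dots>, s0\<close> are numbered \<open>0, \<dots>, s0 - 1\<close>, following the matrix indices.\<close>

definition states :: "nat \<Rightarrow> (int \<times> int \<times> nat) set" where
  "states s0 = UNIV \<times> UNIV \<times> {..<s0}"

definition states1 :: "nat \<Rightarrow> (int \<times> int \<times> nat) set" where
  "states1 s0 = UNIV \<times> {0..} \<times> {..<s0}"

definition states2 :: "nat \<Rightarrow> (int \<times> int \<times> nat) set" where
  "states2 s0 = {0..} \<times> UNIV \<times> {..<s0}"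

fun block_trans :: "int set \<Rightarrow> int set \<Rightarrow> (int \<Rightarrow> int \<Rightarrow> real mat) \<Rightarrow>
    int \<times> int \<times> nat \<Rightarrow> int \<times> int \<times> nat \<Rightarrow> real" where
  "block_trans I J B (x1, x2, k) (y1, y2, l) =
     (if y1 - x1 \<in> I \<and> y2 - x2 \<in> J then B (y1 - x1) (y2 - x2) $$ (k, l) else 0)"

definition chain_trans :: "(int \<Rightarrow> int \<Rightarrow> real mat) \<Rightarrow>
    int \<times> int \<times> nat \<Rightarrow> int \<times> int \<times> nat \<Rightarrow> real" where
  "chain_trans A = block_trans HH HH A"

fun chain_trans1 :: "(int \<Rightarrow> int \<Rightarrow> real mat) \<Rightarrow> (int \<Rightarrow> int \<Rightarrow> real mat) \<Rightarrow>
    int \<times> int \<times> nat \<Rightarrow> int \<times> int \<times> nat \<Rightarrow> real" where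
  "chain_trans1 A A1 (x1, x2, k) y =
     (if x2 \<noteq> 0 then block_trans HH HH A (x1, x2, k) y
      else block_trans HH HHp A1 (x1, x2, k) y)"

fun chain_trans2 :: "(int \<Rightarrow> int \<Rightarrow> real mat) \<Rightarrow> (int \<Rightarrow> int \<Rightarrow> real mat) \<Rightarrow>
    int \<times> int \<times> nat \<Rightarrow> int \<times> int \<times> nat \<Rightarrow> real" where
  "chain_trans2 A A2 (x1, x2, k) y =
     (if x1 \<noteq> 0 then block_trans HH HH A (x1, x2, k) y
      else block_trans HHp HH A2 (x1, x2, k) y)"


section \<open>The matrix generating function and its spectral radius\<close>

definition C_mat :: "nat \<Rightarrow> (int \<Rightarrow> int \<Rightarrow> real mat) \<Rightarrow> real \<Rightarrow> real \<Rightarrow> real mat" where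
  "C_mat s0 A z1 z2 = block_sum s0 HH HH (\<lambda>i j. (z1 powi i * z2 powi j) \<cdot>\<^sub>m A i j)"

definition chi :: "nat \<Rightarrow> (int \<Rightarrow> int \<Rightarrow> real mat) \<Rightarrow> real \<Rightarrow> real \<Rightarrow> real" where
  "chi s0 A z1 z2 = spectral_radius (map_mat complex_of_real (C_mat s0 A z1 z2))"

definition Gamma_bar :: "nat \<Rightarrow> (int \<Rightarrow> int \<Rightarrow> real mat) \<Rightarrow> (real \<times> real) set" where
  "Gamma_bar s0 A = {(s1, s2). chi s0 A (exp s1) (exp s2) \<le> 1}"

end

theory Submission
  imports Defs
begin

text \<open>
  A nonnegative matrix \<open>M\<close> with spectral radius at most \<open>1\<close> has polynomially bounded powers, so
  supermultiplicativity of \<open>n \<mapsto> (M\<^sup>n)(k, k)\<close> forces \<open>(M\<^sup>n)(k, k) \<le> 1\<close>. On the other hand,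
  irreducibility of the chain on \<open>\<int>\<^sup>2 \<times> S\<^sub>0\<close> yields, for every displacement \<open>d\<close>, an \<open>n\<close> such that
  moving by \<open>d\<close> and returning to the initial phase in \<open>n\<close> steps has probability \<open>p > 0\<close>, and then
  \<open>p e\<^bsup>d\<bullet>s\<^esup> \<le> (C(e\<^bsup>s\<^sub>1\<^esup>, e\<^bsup>s\<^sub>2\<^esup>)\<^sup>n)(k, k) \<le> 1\<close>, that is, \<open>d\<bullet>s \<le> - ln p\<close>. Taking for \<open>d\<close> the four
  unit vectors \<open>(\<plusminus>1, 0)\<close>, \<open>(0, \<plusminus>1)\<close> confines \<open>s\<close> to a rectangle.
\<close>

lemma pow_mat_add:
  fixes M :: "'a :: semiring_1 mat"
  assumes M: "M \<in> carrier_mat n n"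
  shows "M ^\<^sub>m (a + b) = M ^\<^sub>m a * M ^\<^sub>m b"
proof (induction b)
  case 0
  show ?case using pow_carrier_mat[OF M, of a] M by (simp add: carrier_matD(1)[OF M])
next
  case (Suc b)
  then show ?case
    using assoc_mult_mat[OF pow_carrier_mat[OF M, of a] pow_carrier_mat[OF M, of b] M] by simp
qed

lemma index_mult_mat_sum:
  assumes "A \<in> carrier_mat n n" "B \<in> carrier_mat n n" "k < n" "l < n"
  shows "(A * B) $$ (k, l) = (\<Sum>m<n. A $$ (k, m) * B $$ (m, l))"
  using assms by (auto simp: scalar_prod_def atLeast0LessThan intro!: sum.cong)

lemma nonneg_mat_pow:
  assumes "nonneg_mat n M"
  shows "nonneg_mat n (M ^\<^sub>m a)"
proof (induction a)
  case 0
  then show ?case using assms by (auto simp: nonneg_mat_def)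
next
  case (Suc a)
  have M: "M \<in> carrier_mat n n" and Ma: "M ^\<^sub>m a \<in> carrier_mat n n"
    using assms by (auto simp: nonneg_mat_def)
  show ?case
    using Suc assms M Ma
    by (auto simp: nonneg_mat_def index_mult_mat_sum[OF Ma M] simp del: index_mult_mat(1)
        intro!: sum_nonneg mult_nonneg_nonneg)
qed

text \<open>In the sum for the \<open>(k, k)\<close> entry of a product of powers, keep only the
  term with intermediate index \<open>k\<close>; the other terms are nonnegative.\<close>

lemma diag_pow_mat_supermult:
  assumes M: "nonneg_mat n M" and k: "k < n"
  shows "((M ^\<^sub>m a) $$ (k, k)) ^ b \<le> (M ^\<^sub>m (a * b)) $$ (k, k)"
proof (induction b)
  case 0
  show ?case using M k by (auto simp: nonneg_mat_def)
next
  case (Suc b)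
  have carrier: "M \<in> carrier_mat n n" "\<And>j. M ^\<^sub>m j \<in> carrier_mat n n"
    using M by (auto simp: nonneg_mat_def)
  have nonneg: "0 \<le> (M ^\<^sub>m j) $$ (i, l)" if "i < n" "l < n" for i l j
    using nonneg_mat_pow[OF M, of j] that by (auto simp: nonneg_mat_def)
  have "((M ^\<^sub>m a) $$ (k, k)) ^ Suc b
      \<le> (M ^\<^sub>m a) $$ (k, k) * (M ^\<^sub>m (a * b)) $$ (k, k)"
    using Suc nonneg[OF k k] by (simp add: mult_left_mono)
  also have "\<dots> \<le> (\<Sum>m<n. (M ^\<^sub>m a) $$ (k, m) * (M ^\<^sub>m (a * b)) $$ (m, k))"
    using k nonneg by (intro member_le_sum) auto
  also have "\<dots> = (M ^\<^sub>m (a * Suc b)) $$ (k, k)"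
    using carrier k by (simp add: pow_mat_add[OF carrier(1)] index_mult_mat_sum[of _ n]
        del: index_mult_mat(1))
  finally show ?case .
qed

text \<open>If \<open>a > 1\<close>, dividing the bound by \<open>a ^ k\<close> leaves a quantity
  that is at least 1 but tends to 0.\<close>

lemma geometric_poly_bound_imp_le_1:
  fixes a c c' :: real
  assumes bound: "\<And>k::nat. a ^ k \<le> c + c' * real k ^ d"
  shows "a \<le> 1"
proof (rule ccontr)
  assume "\<not> a \<le> 1"
  hence a: "a > 1" by simp
  \<comment> \<open>With \<open>a ^ k = exp (L * real k)\<close>, the limit of
    \<open>x ^ e / exp x\<close> applies at \<open>x = L * real k\<close>: with \<open>e = 0\<close>
    for the constant term, and with \<open>e = d\<close> after compensating by
    \<open>1 / L ^ d\<close>.\<close>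
  define L where "L = ln a"
  have L: "L > 0" using a by (simp add: L_def)
  have lim: "filterlim (\<lambda>k. L * real k) at_top sequentially"
    using L by (intro filterlim_tendsto_pos_mult_at_top[OF tendsto_const _ filterlim_real_sequentially])
  have pow: "(\<lambda>k. (L * real k) ^ e / exp (L * real k)) \<longlonglongrightarrow> 0" for e
    using filterlim_compose[OF tendsto_power_div_exp_0 lim] by simp
  have "(\<lambda>k. c * ((L * real k) ^ 0 / exp (L * real k))
      + c' / L ^ d * ((L * real k) ^ d / exp (L * real k))) \<longlonglongrightarrow> c * 0 + c' / L ^ d * 0"
    by (intro tendsto_intros pow)
  moreover have "c * ((L * real k) ^ 0 / exp (L * real k))
      + c' / L ^ d * ((L * real k) ^ d / exp (L * real k)) \<ge> 1" for k
  proof -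
    have "exp (L * real k) = a ^ k"
      using a by (simp add: L_def exp_of_nat2_mult)
    hence "1 \<le> (c + c' * real k ^ d) / exp (L * real k)"
      using bound[of k] a by (simp add: le_divide_eq)
    also have "\<dots> = c * ((L * real k) ^ 0 / exp (L * real k))
      + c' / L ^ d * ((L * real k) ^ d / exp (L * real k))"
      using L by (simp add: field_simps power_mult_distrib)
    finally show ?thesis .
  qed
  ultimately have "(1::real) \<le> c * 0 + c' / L ^ d * 0"
    by (intro LIMSEQ_le_const) auto
  thus False by simp
qed

text \<open>Jordan blocks for eigenvalues of modulus 1 allow polynomial growth of the powers, but a
  diagonal entry above 1 would grow geometrically along the multiples of \<open>a\<close>.\<close>

lemma diag_pow_le_1_if_spectral_radius_le_1:
  assumes M: "nonneg_mat n M" and k: "k < n"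
    and sr: "spectral_radius (map_mat complex_of_real M) \<le> 1"
  shows "(M ^\<^sub>m a) $$ (k, k) \<le> 1"
proof -
  let ?N = "map_mat complex_of_real M"
  have carrier: "M \<in> carrier_mat n n" "\<And>j. M ^\<^sub>m j \<in> carrier_mat n n"
    using M by (auto simp: nonneg_mat_def)
  obtain c c' where bound: "\<And>j. norm_bound (?N ^\<^sub>m j) (c + c' * real j ^ (n - 1))"
    using spectral_radius_jnf_norm_bound_le_1_upper_triangular[of ?N n] carrier sr by auto
  have "((M ^\<^sub>m a) $$ (k, k)) ^ j \<le> c + (c' * real a ^ (n - 1)) * real j ^ (n - 1)" for j
  proof -
    have "((M ^\<^sub>m a) $$ (k, k)) ^ j \<le> (M ^\<^sub>m (a * j)) $$ (k, k)"
      by (rule diag_pow_mat_supermult[OF M k])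
    \<comment> \<open>The embedding into the complex numbers commutes with matrix powers, and a real
      number is at most the norm of its image.\<close>
    also have "\<dots> \<le> norm ((?N ^\<^sub>m (a * j)) $$ (k, k))"
      using k carrier_matD[OF carrier(2)[of "a * j"]] of_real_hom.mat_hom_pow[OF carrier(1), where 'a = complex, symmetric]
      by simp
    also have "\<dots> \<le> c + c' * real (a * j) ^ (n - 1)"
      using bound[of "a * j"] k carrier by (auto simp: norm_bound_def)
    finally show ?thesis by (simp add: power_mult_distrib mult_ac)
  qed
  thus ?thesis by (rule geometric_poly_bound_imp_le_1)
qed

lemma index_C_mat:
  assumes "stochastic_blocks n HH HH A" "k < n" "l < n"
  shows "C_mat n A z1 z2 $$ (k, l)
    = (\<Sum>i\<in>HH. \<Sum>j\<in>HH. z1 powi i * z2 powi j * A i j $$ (k, l))"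
proof -
  have "A i j \<in> carrier_mat n n" if "i \<in> HH" "j \<in> HH" for i j
    using assms(1) that by (auto simp: stochastic_blocks_def nonneg_mat_def)
  then have "dim_row (A i j) = n" "dim_col (A i j) = n" if "i \<in> HH" "j \<in> HH" for i j
    using that by blast+
  with assms(2,3) show ?thesis
    by (simp add: C_mat_def block_sum_def)
qed

lemma nonneg_C_mat:
  assumes A: "stochastic_blocks n HH HH A" and "z1 > 0" "z2 > 0"
  shows "nonneg_mat n (C_mat n A z1 z2)"
  unfolding nonneg_mat_def
proof (intro conjI allI impI)
  show "C_mat n A z1 z2 \<in> carrier_mat n n"
    by (simp add: C_mat_def block_sum_def)
  show "0 \<le> C_mat n A z1 z2 $$ (k, l)" if "k < n" "l < n" for k l
    using assms that
    by (auto simp: index_C_mat[OF A] stochastic_blocks_def nonneg_mat_def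
        intro!: sum_nonneg mult_nonneg_nonneg)
qed

text \<open>One step reaches only neighbouring positions, so the infinite sum over states collapses
  to a finite one over phases and displacements, which \<open>?g\<close> parametrizes
  injectively.\<close>

lemma n_step_chain_trans_Suc:
  "n_step (states s) (chain_trans A) (Suc n) (x1, x2, k) y
    = (\<Sum>m<s. \<Sum>i\<in>HH. \<Sum>j\<in>HH.
        A i j $$ (k, m) * n_step (states s) (chain_trans A) n (x1 + i, x2 + j, m) y)"
proof -
  let ?f = "\<lambda>z. chain_trans A (x1, x2, k) z * n_step (states s) (chain_trans A) n z y"
  let ?g = "\<lambda>(m, i, j). (x1 + i, x2 + j, m)"
  let ?D = "{..<s} \<times> HH \<times> HH"
  have fin: "finite ?D" by (simp add: HH_def)
  have inj: "inj_on ?g ?D" by (auto simp: inj_on_def)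
  have zero: "?f z = 0" if "z \<in> states s - ?g ` ?D" for z
  proof -
    obtain z1 z2 m where z: "z = (z1, z2, m)" by (cases z)
    have "\<not> (z1 - x1 \<in> HH \<and> z2 - x2 \<in> HH)"
    proof
      assume "z1 - x1 \<in> HH \<and> z2 - x2 \<in> HH"
      hence "z \<in> ?g ` ?D"
        using that z by (intro image_eqI[where x = "(m, z1 - x1, z2 - x2)"]) (auto simp: states_def)
      thus False using that by simp
    qed
    thus ?thesis by (auto simp: z chain_trans_def)
  qed
  have "n_step (states s) (chain_trans A) (Suc n) (x1, x2, k) y = infsum ?f (?g ` ?D)"
    using zero by (auto simp: states_def intro!: infsum_cong_neutral)
  also have "\<dots> = sum ?f (?g ` ?D)"
    using fin by (intro infsum_finite) auto
  also have "\<dots> = (\<Sum>(m, i, j)\<in>?D. ?f (x1 + i, x2 + j, m))"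
    by (subst sum.reindex[OF inj]) (simp add: case_prod_unfold comp_def)
  also have "\<dots> = (\<Sum>m<s. \<Sum>i\<in>HH. \<Sum>j\<in>HH. ?f (x1 + i, x2 + j, m))"
    by (simp add: sum.cartesian_product)
  finally show ?thesis by (simp add: chain_trans_def)
qed

text \<open>By translation invariance, the entry of the \<open>n\<close>-th power is the generating
  function of the displacement after \<open>n\<close> steps from phase \<open>k\<close> to phase
  \<open>l\<close>; the left side is a single nonnegative term of it. The induction splits off the
  first step, hence the arbitrary starting state.\<close>

lemma n_step_chain_trans_le_C_mat_pow:
  assumes A: "stochastic_blocks s HH HH A" and z: "z1 > 0" "z2 > 0"
    and l: "l < s" and k: "k < s"
  shows "n_step (states s) (chain_trans A) n (x1, x2, k) (y1, y2, l)
      * (z1 powi (y1 - x1) * z2 powi (y2 - x2)) \<le> (C_mat s A z1 z2 ^\<^sub>m n) $$ (k, l)"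
  using k
proof (induction n arbitrary: x1 x2 k)
  case 0
  have "C_mat s A z1 z2 \<in> carrier_mat s s"
    using nonneg_C_mat[OF A z] by (simp add: nonneg_mat_def)
  then show ?case using 0 l by auto
next
  case (Suc n)
  let ?C = "C_mat s A z1 z2" and ?p = "n_step (states s) (chain_trans A) n"
  let ?w = "\<lambda>u v. z1 powi u * z2 powi v"
  have C: "?C \<in> carrier_mat s s" "?C ^\<^sub>m n \<in> carrier_mat s s"
    using nonneg_C_mat[OF A z] by (auto simp: nonneg_mat_def)
  have Ann: "0 \<le> A i j $$ (k, m)" if "i \<in> HH" "j \<in> HH" "m < s" for i j m
    using A that Suc.prems by (auto simp: stochastic_blocks_def nonneg_mat_def)
  \<comment> \<open>The weight is multiplicative in the displacement: the factor of the first step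
    goes into \<open>?C\<close>, the rest into the induction hypothesis.\<close>
  have shift: "?w (y1 - x1) (y2 - x2) = ?w i j * ?w (y1 - (x1 + i)) (y2 - (x2 + j))" for i j
  proof -
    have "z1 powi (y1 - x1) = z1 powi i * z1 powi (y1 - (x1 + i))"
      "z2 powi (y2 - x2) = z2 powi j * z2 powi (y2 - (x2 + j))"
      using z by (simp_all flip: power_int_add)
    thus ?thesis by simp
  qed
  have "n_step (states s) (chain_trans A) (Suc n) (x1, x2, k) (y1, y2, l) * ?w (y1 - x1) (y2 - x2)
    = (\<Sum>m<s. \<Sum>i\<in>HH. \<Sum>j\<in>HH. A i j $$ (k, m) * ?p (x1 + i, x2 + j, m) (y1, y2, l)
        * ?w (y1 - x1) (y2 - x2))"
    by (simp only: n_step_chain_trans_Suc sum_distrib_right)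
  also have "\<dots> = (\<Sum>m<s. \<Sum>i\<in>HH. \<Sum>j\<in>HH. ?w i j * A i j $$ (k, m)
      * (?p (x1 + i, x2 + j, m) (y1, y2, l) * ?w (y1 - (x1 + i)) (y2 - (x2 + j))))"
  proof (intro sum.cong refl)
    fix m i j
    show "A i j $$ (k, m) * ?p (x1 + i, x2 + j, m) (y1, y2, l) * ?w (y1 - x1) (y2 - x2)
      = ?w i j * A i j $$ (k, m)
        * (?p (x1 + i, x2 + j, m) (y1, y2, l) * ?w (y1 - (x1 + i)) (y2 - (x2 + j)))"
      unfolding shift[of i j] by (simp only: mult_ac)
  qed
  also have "\<dots> \<le> (\<Sum>m<s. \<Sum>i\<in>HH. \<Sum>j\<in>HH. ?w i j * A i j $$ (k, m) * (?C ^\<^sub>m n) $$ (m, l))"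
    using z Ann Suc.IH by (intro sum_mono mult_left_mono) auto
  also have "\<dots> = (?C * ?C ^\<^sub>m n) $$ (k, l)"
    using C Suc.prems l
    by (simp add: index_mult_mat_sum[of _ s] index_C_mat[OF A] sum_distrib_right
        del: index_mult_mat(1))
  \<comment> \<open>Matrix powers put the new factor on the right, whereas the first-step recursion
    produces it on the left.\<close>
  also have "?C * ?C ^\<^sub>m n = ?C ^\<^sub>m Suc n"
    using pow_mat_add[OF C(1), of 1 n] C by simp
  finally show ?case .
qed

lemma Gamma_bar_halfplane:
  fixes d1 d2 :: int
  assumes A: "stochastic_blocks s HH HH A" and s: "s \<ge> 1"
    and irr: "irreducible_chain (states s) (chain_trans A)"
  shows "\<exists>b. \<forall>(s1, s2)\<in>Gamma_bar s A. of_int d1 * s1 + of_int d2 * s2 \<le> b"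
proof -
  \<comment> \<open>\<open>n\<close> and \<open>?p\<close> are fixed before \<open>(s1, s2)\<close>,
    so \<open>- ln ?p\<close> bounds the whole set uniformly. Returning to phase 0, which exists
    since \<open>s \<ge> 1\<close>, makes the relevant entry a diagonal one.\<close>
  obtain n where pos: "n_step (states s) (chain_trans A) n (0, 0, 0) (d1, d2, 0) > 0" (is "?p > 0")
    using irr s by (force simp: irreducible_chain_def states_def)
  have "of_int d1 * s1 + of_int d2 * s2 \<le> - ln ?p" if "(s1, s2) \<in> Gamma_bar s A" for s1 s2
  proof -
    have "?p * exp (of_int d1 * s1 + of_int d2 * s2)
        = ?p * (exp s1 powi (d1 - 0) * exp s2 powi (d2 - 0))"
      by (simp add: exp_add exp_power_int mult.commute)
    also have "\<dots> \<le> (C_mat s A (exp s1) (exp s2) ^\<^sub>m n) $$ (0, 0)"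
      using s by (intro n_step_chain_trans_le_C_mat_pow[OF A]) auto
    also have "\<dots> \<le> 1"
      using that s by (intro diag_pow_le_1_if_spectral_radius_le_1[of s] nonneg_C_mat[OF A])
        (auto simp: Gamma_bar_def chi_def)
    finally have "exp (of_int d1 * s1 + of_int d2 * s2) \<le> 1 / ?p"
      using pos by (simp add: field_simps)
    also have "1 / ?p = exp (- ln ?p)"
      using pos by (simp add: exp_minus field_simps)
    finally show ?thesis by simp
  qed
  thus ?thesis by blast
qed

theorem lemma2p2:
  fixes s0 :: nat
    and A A1 A2 :: "int \<Rightarrow> int \<Rightarrow> real mat"
  assumes "s0 \<ge> 1"
    and "stochastic_blocks s0 HH HH A"
    and "stochastic_blocks s0 HH HHp A1"
    and "stochastic_blocks s0 HHp HH A2"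
    and "irreducible_chain (states s0) (chain_trans A)"
    and "aperiodic_chain (states s0) (chain_trans A)"
    and "irreducible_chain (states1 s0) (chain_trans1 A A1)"
    and "aperiodic_chain (states1 s0) (chain_trans1 A A1)"
    and "irreducible_chain (states2 s0) (chain_trans2 A A2)"
    and "aperiodic_chain (states2 s0) (chain_trans2 A A2)"
  shows "bounded (Gamma_bar s0 A)"
proof -
  have half: "\<exists>b. \<forall>(s1, s2)\<in>Gamma_bar s0 A. of_int d1 * s1 + of_int d2 * s2 \<le> b" for d1 d2 :: int
    using Gamma_bar_halfplane assms(1,2,5) by blast
  obtain b1 b2 b3 b4 where
    b1: "\<forall>(s1, s2)\<in>Gamma_bar s0 A. s1 \<le> b1" and b2: "\<forall>(s1, s2)\<in>Gamma_bar s0 A. - s1 \<le> b2" and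
    b3: "\<forall>(s1, s2)\<in>Gamma_bar s0 A. s2 \<le> b3" and b4: "\<forall>(s1, s2)\<in>Gamma_bar s0 A. - s2 \<le> b4"
    using half[of 1 0] half[of "-1" 0] half[of 0 1] half[of 0 "-1"] by auto
  have "Gamma_bar s0 A \<subseteq> {- b2..b1} \<times> {- b4..b3}"
    using b1 b2 b3 b4 by fastforce
  moreover have "bounded ({- b2..b1} \<times> {- b4..b3})"
    by (intro bounded_Times compact_imp_bounded compact_Icc)
  ultimately show ?thesis by (rule bounded_subset[rotated])
qed

end
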